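(* Let $s\in(\frac12,1)$ and let $\gamma=\frac{s}{1-s}$. Let $\beta=10\left(1-2^{\frac{1-\gamma}{\gamma}}\right)^{-1}$ and let $\mu$ be the measure on $\mathbb{R}$ given by $d\mu(x)=x^{\frac1\gamma}1_{[0,\beta]}(x)\,dx$. Set $A=[0,1]\cup[2,\beta]$. Then the function $t\mapsto\mu(A+t[-1,1])$ is not $s$-concave on $\mathbb{R}_+ = [0,+\infty)$.
   Context: $A+B=\{a+b : a\in A,\,b\in B\}$ is the Minkowski sum. For $s\in(0,1)$, a non-negative function $F$ on $\mathbb{R}_+$ is $s$-concave if $F((1-\lambda)t_1+\lambda t_2)\ge\left((1-\lambda)F(t_1)^s+\lambda F(t_2)^s\right)^{1/s}$ for every $\lambda\in[0,1]$ and all $t_1,t_2\in\mathbb{R}_+$ with $F(t_1)F(t_2)>0$. *)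

theory Defs
  imports "HOL-Analysis.Analysis" "HOL-Library.Set_Algebras"
begin

text \<open>
  \<open>s\<close>-concavity on the half-line of a function that is non-negative there; values of \<open>F\<close> at
  negative arguments are irrelevant.
\<close>

definition s_concave_on_half_line :: "real \<Rightarrow> (real \<Rightarrow> real) \<Rightarrow> bool" where
  "s_concave_on_half_line s F \<longleftrightarrow>
     (\<forall>l\<in>{0..1}. \<forall>t1\<in>{0..}. \<forall>t2\<in>{0..}. F t1 * F t2 > 0 \<longrightarrow>
        F ((1 - l) * t1 + l * t2) \<ge> ((1 - l) * F t1 powr s + l * F t2 powr s) powr (1 / s))"

definition power_density_measure :: "real \<Rightarrow> real \<Rightarrow> real measure" where
  "power_density_measure \<gamma> \<beta> =
     density lborel (\<lambda>x. ennreal (x powr (1 / \<gamma>) * indicator {0..\<beta>} x))"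

text \<open>
  The real-valued \<^const>\<open>measure\<close> returns \<open>0\<close> on sets of infinite measure and on non-measurable
  sets. The next two facts show that neither case occurs for the sets considered here.
\<close>

lemma finite_measure_power_density_measure:
  assumes "\<gamma> > 0"
  shows "finite_measure (power_density_measure \<gamma> \<beta>)"
proof (rule finite_measureI)
  have "emeasure (power_density_measure \<gamma> \<beta>) (space (power_density_measure \<gamma> \<beta>)) =
      (\<integral>\<^sup>+x. ennreal (x powr (1 / \<gamma>) * indicator {0..\<beta>} x) \<partial>lborel)"
    by (simp add: power_density_measure_def emeasure_density)
  also have "\<dots> \<le> (\<integral>\<^sup>+x. ennreal (\<beta> powr (1 / \<gamma>)) * indicator {0..\<beta>} x \<partial>lborel)"
    using assms by (intro nn_integral_mono) (auto simp: indicator_def intro!: ennreal_leI powr_mono2)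
  also have "\<dots> = ennreal (\<beta> powr (1 / \<gamma>)) * emeasure lborel {0..\<beta>}"
    by (simp add: nn_integral_cmult)
  also have "\<dots> < \<infinity>"
    by (simp add: ennreal_mult_less_top emeasure_lborel_Icc_eq)
  finally show "emeasure (power_density_measure \<gamma> \<beta>) (space (power_density_measure \<gamma> \<beta>)) \<noteq> \<infinity>"
    by simp
qed

lemma sets_power_density_measure_plus_interval:
  fixes A :: "real set"
  assumes "compact A"
  shows "A + (*) t ` {-1..1} \<in> sets (power_density_measure \<gamma> \<beta>)"
proof -
  have "compact ((*) t ` {-1..1})"
    by (intro compact_continuous_image continuous_intros) auto
  then have "compact {x + y | x y. x \<in> A \<and> y \<in> (*) t ` {-1..1}}"
    by (rule compact_sums[OF assms])
  also have "{x + y | x y. x \<in> A \<and> y \<in> (*) t ` {-1..1}} = A + (*) t ` {-1..1}"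
    by (auto simp: set_plus_def)
  finally show ?thesis
    by (simp add: power_density_measure_def borel_compact)
qed

end

theory Submission
  imports Defs
begin

text \<open>
  With \<open>p = 1 / s\<close> and \<open>0 \<le> t < 1 / 2\<close> the measure of \<open>A + t [-1, 1]\<close> is \<open>P t / p\<close>, where
  \<open>P t = \<beta>\<^sup>p - (2 - t)\<^sup>p + (1 + t)\<^sup>p\<close>. The second derivative of \<open>P\<^sup>s\<close> at \<open>0\<close> has the sign of
  \<open>(1 - 2\<^bsup>p - 2\<^esup>) P 0 - (2\<^bsup>p - 1\<^esup> + 1)\<^sup>2\<close>. The subtracted square is less than \<open>9\<close>, and \<open>\<beta>\<close> is chosen so
  large that the first term exceeds \<open>9\<close>. So \<open>P\<^sup>s\<close> is strictly convex near \<open>0\<close>.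
\<close>

text \<open>The mean value theorem on the two halves, which have equal length, gives slopes
  \<open>f' x\<close> and \<open>f' y\<close> with \<open>x < m < y\<close>, and \<open>f'\<close>
  increases strictly because its derivative is positive.\<close>

lemma midpoint_less_if_deriv2_pos:
  fixes f f' f'' :: "real \<Rightarrow> real"
  assumes "a < b"
    and f: "\<And>x. a \<le> x \<Longrightarrow> x \<le> b \<Longrightarrow> (f has_real_derivative f' x) (at x)"
    and f': "\<And>x. a \<le> x \<Longrightarrow> x \<le> b \<Longrightarrow> (f' has_real_derivative f'' x) (at x)"
    and pos: "\<And>x. a \<le> x \<Longrightarrow> x \<le> b \<Longrightarrow> f'' x > 0"
  shows "f ((a + b) / 2) < (f a + f b) / 2"
proof -
  define m where "m = (a + b) / 2"
  have m: "a < m" "m < b" "m - a = (b - a) / 2" "b - m = (b - a) / 2"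
    using \<open>a < b\<close> by (auto simp: m_def field_simps)
  obtain x where x: "a < x" "x < m" "f m - f a = (m - a) * f' x"
    using MVT2[of a m f f'] m f by auto
  obtain y where y: "m < y" "y < b" "f b - f m = (b - m) * f' y"
    using MVT2[of m b f f'] m f by auto
  have "f' x < f' y"
  proof (rule DERIV_pos_imp_increasing[of x y f'])
    show "x < y"
      using x y by simp
    fix z assume "x \<le> z" "z \<le> y"
    then have "a \<le> z" "z \<le> b"
      using x y by auto
    then show "\<exists>d. (f' has_real_derivative d) (at z) \<and> d > 0"
      using f' pos by blast
  qed
  then have "(b - a) / 2 * f' x < (b - a) / 2 * f' y"
    using \<open>a < b\<close> by simp
  then have "f m - f a < f b - f m"
    using x(3) y(3) unfolding m(3,4) by linarith
  then show ?thesis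
    by (simp add: m_def[symmetric])
qed

lemma has_integral_powr_interval:
  fixes a b q :: real
  assumes "0 < q" "0 \<le> a" "a \<le> b"
  shows "((\<lambda>x. x powr q) has_integral (b powr (q + 1) - a powr (q + 1)) / (q + 1)) {a..b}"
proof -
  have "((\<lambda>x. x powr q) has_integral b powr (q + 1) / (q + 1) - a powr (q + 1) / (q + 1)) {a..b}"
  \<comment> \<open>The left end may be 0, where the derivative rule for \<open>powr\<close> does
    not apply. So the antiderivative is differentiated only in the interior and is merely continuous
    at the ends.\<close>
  proof (rule fundamental_theorem_of_calculus_interior[OF \<open>a \<le> b\<close>])
    show "continuous_on {a..b} (\<lambda>x. x powr (q + 1) / (q + 1))"
      using assms by (intro continuous_intros continuous_on_powr') auto
  next
    fix x assume "x \<in> {a<..<b}"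
    then have "((\<lambda>x. x powr (q + 1) / (q + 1)) has_real_derivative x powr q) (at x)"
      using assms by (auto intro!: derivative_eq_intros)
    then show "((\<lambda>x. x powr (q + 1) / (q + 1)) has_vector_derivative x powr q) (at x)"
      by (simp add: has_real_derivative_iff_has_vector_derivative)
  qed
  then show ?thesis
    by (simp add: diff_divide_distrib)
qed

lemma measure_power_density_measure_Icc:
  assumes "\<gamma> > 0" "0 \<le> a" "a \<le> b" "b \<le> \<beta>"
  shows "measure (power_density_measure \<gamma> \<beta>) {a..b} =
    (b powr (1 / \<gamma> + 1) - a powr (1 / \<gamma> + 1)) / (1 / \<gamma> + 1)"
proof -
  have "emeasure (power_density_measure \<gamma> \<beta>) {a..b} =
      (\<integral>\<^sup>+x. ennreal (indicator {a..b} x * x powr (1 / \<gamma>)) \<partial>lborel)"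
    using assms unfolding power_density_measure_def
    by (subst emeasure_density) (auto simp: indicator_def intro!: nn_integral_cong)
  also have "\<dots> = ennreal ((b powr (1 / \<gamma> + 1) - a powr (1 / \<gamma> + 1)) / (1 / \<gamma> + 1))"
    using assms by (intro nn_integral_has_integral_lebesgue has_integral_powr_interval) auto
  finally show ?thesis
  proof (rule measure_eq_emeasure_eq_ennreal[rotated])
    have "a powr (1 / \<gamma> + 1) \<le> b powr (1 / \<gamma> + 1)"
      using assms by (intro powr_mono2) auto
    then show "0 \<le> (b powr (1 / \<gamma> + 1) - a powr (1 / \<gamma> + 1)) / (1 / \<gamma> + 1)"
      using \<open>\<gamma> > 0\<close> by (intro divide_nonneg_nonneg) auto
  qed
qed

text \<open>The density vanishes outside \<open>{0..\<beta>}\<close>. This discards what the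
  enlarged set gains below 0 and above \<open>\<beta>\<close>.\<close>

lemma measure_power_density_measure_Int:
  assumes "S \<in> sets borel"
  shows "measure (power_density_measure \<gamma> \<beta>) S =
    measure (power_density_measure \<gamma> \<beta>) (S \<inter> {0..\<beta>})"
proof -
  have "emeasure (power_density_measure \<gamma> \<beta>) S = emeasure (power_density_measure \<gamma> \<beta>) (S \<inter> {0..\<beta>})"
    using assms unfolding power_density_measure_def
    by (subst (1 2) emeasure_density) (auto simp: indicator_def intro!: nn_integral_cong)
  then show ?thesis
    by (simp add: measure_def)
qed

lemma two_intervals_plus_interval:
  fixes t \<beta> :: real
  assumes "0 \<le> t" "t < 1 / 2" "2 \<le> \<beta>"
  shows "({0..1} \<union> {2..\<beta>} + (*) t ` {-1..1}) \<inter> {0..\<beta>} = {0..1 + t} \<union> {2 - t..\<beta>}"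
proof -
  have "(*) t ` {-1..1} = {- t..t}"
    using assms by (simp add: image_mult_atLeastAtMost_if)
  \<comment> \<open>The summand taken from \<open>A\<close> is the nearest point of
    \<open>{0..1}\<close>, namely \<open>min x 1\<close>; the remainder lies between 0 and
    \<open>t\<close>. For the second interval \<open>max x 2\<close> plays the same role.\<close>
  moreover have "x \<in> {0..1} \<union> {2..\<beta>} + {- t..t}" if "x \<in> {0..1 + t}" for x
    using that assms set_plus_intro[of "min x 1" "{0..1} \<union> {2..\<beta>}" "x - min x 1" "{- t..t}"]
    by (auto simp: min_def split: if_splits)
  moreover have "x \<in> {0..1} \<union> {2..\<beta>} + {- t..t}" if "x \<in> {2 - t..\<beta>}" for x
    using that assms set_plus_intro[of "max x 2" "{0..1} \<union> {2..\<beta>}" "x - max x 2" "{- t..t}"]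
    by (auto simp: max_def split: if_splits)
  ultimately show ?thesis
    using assms by (auto elim!: set_plus_elim)
qed

lemma measure_two_intervals_plus_interval:
  fixes t \<beta> \<gamma> :: real
  defines "p \<equiv> 1 / \<gamma> + 1"
  assumes "\<gamma> > 0" "0 \<le> t" "t < 1 / 2" "2 \<le> \<beta>"
  shows "measure (power_density_measure \<gamma> \<beta>) ({0..1} \<union> {2..\<beta>} + (*) t ` {-1..1}) =
    (\<beta> powr p - (2 - t) powr p + (1 + t) powr p) / p"
proof -
  let ?\<mu> = "power_density_measure \<gamma> \<beta>" and ?S = "{0..1} \<union> {2..\<beta>} + (*) t ` {-1..1}"
  interpret finite_measure ?\<mu>
    using \<open>\<gamma> > 0\<close> by (rule finite_measure_power_density_measure)
  have sets: "sets ?\<mu> = sets borel"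
    by (simp add: power_density_measure_def)
  have "?S \<in> sets borel"
    using sets_power_density_measure_plus_interval[of "{0..1} \<union> {2..\<beta>}" t \<gamma> \<beta>] sets by auto
  then have "measure ?\<mu> ?S = measure ?\<mu> ({0..1 + t} \<union> {2 - t..\<beta>})"
    using assms by (subst measure_power_density_measure_Int) (simp_all add: two_intervals_plus_interval)
  \<comment> \<open>The pieces are disjoint: \<open>t < 1 / 2\<close> gives
    \<open>1 + t < 2 - t\<close>, so the gap of \<open>A\<close> is not yet filled.\<close>
  also have "\<dots> = measure ?\<mu> {0..1 + t} + measure ?\<mu> {2 - t..\<beta>}"
    using assms sets by (intro finite_measure_Union) auto
  also have "\<dots> = (\<beta> powr p - (2 - t) powr p + (1 + t) powr p) / p"
    using assms by (simp add: measure_power_density_measure_Icc add_divide_distrib diff_divide_distrib)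
  finally show ?thesis .
qed

lemma deriv2_numerator_at_0_pos:
  fixes p :: real
  defines "\<beta> \<equiv> 10 * inverse (1 - 2 powr (p - 2))"
  assumes "1 < p" "p < 2"
  shows "\<beta> \<ge> 20"
    and "(\<beta> powr p - 2 powr p + 1) * (1 - 2 powr (p - 2)) > (2 powr (p - 1) + 1)\<^sup>2"
proof -
  define c where "c = 1 - 2 powr (p - 2)"
  have "2 powr (p - 2) < 2 powr 0" "2 powr (p - 2) > 2 powr (- 1)"
    using assms by (intro powr_less_mono; simp)+
  then have c: "0 < c" "c < 1 / 2"
    by (auto simp: c_def powr_minus)
  have \<beta>: "\<beta> * c = 10"
    using c by (simp add: \<beta>_def c_def[symmetric])
  have "20 * c \<le> \<beta> * c"
    using c \<beta> by simp
  then show \<beta>20: "\<beta> \<ge> 20"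
    using c by simp
  \<comment> \<open>Factoring out \<open>2 powr p\<close> absorbs the subtracted term: both factors
    of \<open>2 powr p * ((\<beta> / 2) powr p - 1)\<close> decrease when \<open>p\<close> is
    lowered to 1, which leaves \<open>\<beta> - 2\<close>.\<close>
  have "(\<beta> / 2) powr 1 \<le> (\<beta> / 2) powr p"
    using \<beta>20 assms by (intro powr_mono) auto
  then have "2 powr 1 * (\<beta> / 2 - 1) \<le> 2 powr p * ((\<beta> / 2) powr p - 1)"
    using \<beta>20 assms by (intro mult_mono powr_mono) auto
  also have "\<dots> = \<beta> powr p - 2 powr p"
    using \<beta>20 by (simp add: right_diff_distrib powr_mult[symmetric])
  finally have "\<beta> - 1 \<le> \<beta> powr p - 2 powr p + 1"
    by simp
  then have "(\<beta> - 1) * c \<le> (\<beta> powr p - 2 powr p + 1) * c"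
    using c by (intro mult_right_mono) auto
  \<comment> \<open>Here the constant 10 enters: \<open>(\<beta> - 1) * c = 10 - c\<close> with
    \<open>c < 1 / 2\<close>, which beats the bound 9 obtained from
    \<open>2 powr (p - 1) < 2\<close>.\<close>
  moreover have "(\<beta> - 1) * c > 9"
    using c \<beta> by (simp add: left_diff_distrib)
  moreover have "2 powr (p - 1) < 2 powr (1 :: real)"
    using assms by (intro powr_less_mono) auto
  then have "(2 powr (p - 1) + 1)\<^sup>2 < (3 :: real)\<^sup>2"
    by (intro power_strict_mono) auto
  ultimately show "(\<beta> powr p - 2 powr p + 1) * (1 - 2 powr (p - 2)) > (2 powr (p - 1) + 1)\<^sup>2"
    by (simp add: c_def)
qed

lemma powr_profile_pos:
  fixes p t \<beta> :: real
  assumes "0 < p" "0 \<le> t" "t < 2" "2 \<le> \<beta>"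
  shows "\<beta> powr p - (2 - t) powr p + (1 + t) powr p > 0"
proof -
  have "(2 - t) powr p \<le> \<beta> powr p"
    using assms by (intro powr_mono2) auto
  moreover have "(1 + t) powr p > 0"
    using assms by simp
  ultimately show ?thesis
    by linarith
qed

text \<open>The hypothesis \<open>large\<close> says that the factor deciding the sign of the second
  derivative of \<open>P t powr s\<close> is positive at 0. By continuity it stays positive on some
  \<open>{0..e}\<close>, where the midpoint criterion applies.\<close>

lemma powr_profile_midpoint_less:
  fixes s \<beta> :: real
  defines "p \<equiv> 1 / s"
  defines "P \<equiv> \<lambda>t. \<beta> powr p - (2 - t) powr p + (1 + t) powr p"
  assumes s: "0 < s" "s < 1" and "2 \<le> \<beta>"
    and large: "P 0 * (1 - 2 powr (p - 2)) > (2 powr (p - 1) + 1)\<^sup>2"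
  obtains e where "0 < e" "e < 1 / 2" "P (e / 2) powr s < (P 0 powr s + P e powr s) / 2"
proof -
  \<comment> \<open>The derivatives are \<open>P' = p * Q\<close> and
    \<open>Q' = (p - 1) * R\<close>. As \<open>s * p = 1\<close>, the first derivative of
    \<open>P powr s\<close> is \<open>P powr (s - 1) * Q\<close> and the second is
    \<open>(p - 1) * P powr (s - 2) * N\<close>.\<close>
  define Q where "Q = (\<lambda>t :: real. (2 - t) powr (p - 1) + (1 + t) powr (p - 1))"
  define R where "R = (\<lambda>t :: real. (1 + t) powr (p - 2) - (2 - t) powr (p - 2))"
  define N where "N = (\<lambda>t. P t * R t - (Q t)\<^sup>2)"
  have p: "p > 1" "s * p = 1"
    using s by (auto simp: p_def)
  have "isCont N 0"
    unfolding N_def P_def Q_def R_def by (intro continuous_intros) auto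
  moreover have "N 0 > 0"
    using large by (simp add: N_def Q_def R_def)
  ultimately have "eventually (\<lambda>t. N t > 0) (nhds 0)"
    unfolding continuous_at by (intro order_tendstoD(1)[of N "N 0"]) (simp_all add: tendsto_nhds_iff)
  then obtain d where d: "d > 0" "\<And>t. dist t 0 < d \<Longrightarrow> N t > 0"
    by (auto simp: eventually_nhds_metric)
  \<comment> \<open>The first bound keeps \<open>{0..e}\<close> where \<open>N\<close> is positive;
    the second keeps \<open>e\<close> below \<open>1 / 2\<close>, where the measure has the form
    \<open>P t / p\<close>.\<close>
  define e where "e = min (d / 2) (1 / 4)"
  have e: "0 < e" "e < 1 / 2" "e < d"
    using d by (auto simp: e_def)
  have P_pos: "P t > 0" if "0 \<le> t" "t \<le> e" for t
    unfolding P_def using that e p \<open>2 \<le> \<beta>\<close> by (intro powr_profile_pos) auto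
  have P_deriv: "(P has_real_derivative p * Q t) (at t)" if "0 \<le> t" "t \<le> e" for t
    using that e unfolding P_def Q_def
    by (auto intro!: derivative_eq_intros simp: algebra_simps)
  have Q_deriv: "(Q has_real_derivative (p - 1) * R t) (at t)" if "0 \<le> t" "t \<le> e" for t
    using that e unfolding Q_def R_def
    by (auto intro!: derivative_eq_intros simp: algebra_simps)
  have "P ((0 + e) / 2) powr s < (P 0 powr s + P e powr s) / 2"
  proof (rule midpoint_less_if_deriv2_pos[where f = "\<lambda>t. P t powr s"
        and f' = "\<lambda>t. P t powr (s - 1) * Q t"
        and f'' = "\<lambda>t. (p - 1) * P t powr (s - 2) * N t"])
    fix t assume t: "0 \<le> t" "t \<le> e"
    have "((\<lambda>t. P t powr s) has_real_derivative s * P t powr (s - 1) * (p * Q t)) (at t)"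
      using DERIV_chain2[OF has_real_derivative_powr[OF P_pos[OF t]] P_deriv[OF t]] .
    also have "s * P t powr (s - 1) * (p * Q t) = s * p * (P t powr (s - 1) * Q t)"
      by (simp only: ac_simps)
    also have "\<dots> = P t powr (s - 1) * Q t"
      using p by simp
    finally show "((\<lambda>t. P t powr s) has_real_derivative P t powr (s - 1) * Q t) (at t)" .
    have "((\<lambda>t. P t powr (s - 1) * Q t) has_real_derivative
        (s - 1) * P t powr (s - 1 - 1) * (p * Q t) * Q t + (p - 1) * R t * P t powr (s - 1)) (at t)"
      using DERIV_mult[OF DERIV_chain2[OF has_real_derivative_powr[OF P_pos[OF t]] P_deriv[OF t]]
          Q_deriv[OF t]] .
    also have "(s - 1) * P t powr (s - 1 - 1) * (p * Q t) * Q t + (p - 1) * R t * P t powr (s - 1) =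
        P t powr (s - 2) * ((s * p - p) * (Q t)\<^sup>2 + (p - 1) * (P t * R t))"
    proof -
      have "P t powr (s - 1) = P t powr (s - 2) * P t"
        using P_pos[OF t] powr_add[of "P t" "s - 2" 1] by simp
      then show ?thesis
        by (simp add: algebra_simps power2_eq_square)
    qed
    \<comment> \<open>With \<open>s * p = 1\<close> the coefficient \<open>s * p - p\<close> is
      \<open>-(p - 1)\<close>, so \<open>p - 1\<close> factors out and \<open>P * R - Q^2\<close>
      remains.\<close>
    also have "\<dots> = (p - 1) * P t powr (s - 2) * N t"
      unfolding p(2) by (simp add: N_def algebra_simps)
    finally show "((\<lambda>t. P t powr (s - 1) * Q t) has_real_derivative
        (p - 1) * P t powr (s - 2) * N t) (at t)" .
    show "(p - 1) * P t powr (s - 2) * N t > 0"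
      using p P_pos[OF t] d(2)[of t] t e by (intro mult_pos_pos) (auto simp: dist_real_def)
  qed (use e in auto)
  with e show ?thesis
    by (intro that) auto
qed

theorem proposition3p3:
  fixes s \<gamma> \<beta> :: real and \<mu> :: "real measure" and A :: "real set"
  assumes "1 / 2 < s" and "s < 1"
    and "\<gamma> = s / (1 - s)"
    and "\<beta> = 10 * inverse (1 - 2 powr ((1 - \<gamma>) / \<gamma>))"
    and "\<mu> = power_density_measure \<gamma> \<beta>"
    and "A = {0..1} \<union> {2..\<beta>}"
  shows "\<not> s_concave_on_half_line s (\<lambda>t. measure \<mu> (A + (*) t ` {-1..1}))"
proof
  assume concave: "s_concave_on_half_line s (\<lambda>t. measure \<mu> (A + (*) t ` {-1..1}))"
  define p where "p = 1 / s"
  define P where "P = (\<lambda>t. \<beta> powr p - (2 - t) powr p + (1 + t) powr p)"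
  define F where "F = (\<lambda>t. measure \<mu> (A + (*) t ` {-1..1}))"
  have p: "1 < p" "p < 2"
    using assms(1,2) by (auto simp: p_def field_simps)
  \<comment> \<open>Both identities come from
    \<open>1 / \<gamma> = (1 - s) / s = p - 1\<close>.\<close>
  have \<gamma>: "\<gamma> > 0" "1 / \<gamma> + 1 = p" "(1 - \<gamma>) / \<gamma> = p - 2"
    using assms(1,2) unfolding assms(3) p_def by (simp_all add: divide_simps)
  have \<beta>: "\<beta> = 10 * inverse (1 - 2 powr (p - 2))"
    using assms(4) \<gamma> by simp
  note large = deriv2_numerator_at_0_pos[OF p, folded \<beta>]
  obtain e where e: "0 < e" "e < 1 / 2" "P (e / 2) powr s < (P 0 powr s + P e powr s) / 2"
    using powr_profile_midpoint_less[of s \<beta>] assms(1,2) large unfolding P_def p_def by auto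
  have F: "F t = P t / p" if "0 \<le> t" "t < 1 / 2" for t
    using measure_two_intervals_plus_interval[of \<gamma> t \<beta>] that \<gamma> large(1)
    by (simp add: F_def P_def assms(5,6))
  have P_pos: "P t > 0" if "0 \<le> t" "t < 1 / 2" for t
    unfolding P_def using that p large(1) by (intro powr_profile_pos) auto
  have "F 0 * F e > 0"
    using e p by (simp add: F P_pos)
  \<comment> \<open>Concavity is tested at 0 and \<open>e\<close> with weight \<open>1 / 2\<close>;
    raising to the power \<open>s\<close> then removes the outer exponent
    \<open>1 / s\<close>.\<close>
  then have "(F 0 powr s / 2 + F e powr s / 2) powr (1 / s) \<le> F (e / 2)"
    using concave[folded F_def, unfolded s_concave_on_half_line_def, rule_format, of "1 / 2" 0 e] e
    by simp
  then have "((F 0 powr s / 2 + F e powr s / 2) powr (1 / s)) powr s \<le> F (e / 2) powr s"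
    using assms(1) by (intro powr_mono2) auto
  then have "F 0 powr s / 2 + F e powr s / 2 \<le> F (e / 2) powr s"
    using assms(1) by (simp add: powr_powr)
  \<comment> \<open>On \<open>[0, 1/2)\<close> the function \<open>F\<close> is
    \<open>P / p\<close>, so each term carries the same factor \<open>1 / p powr s\<close>, which
    cancels and leaves the reverse of the strict midpoint inequality.\<close>
  then have "(P 0 powr s + P e powr s) / 2 / p powr s \<le> P (e / 2) powr s / p powr s"
    using e p P_pos[of 0] P_pos[of e] P_pos[of "e / 2"]
    by (simp add: F powr_divide add_divide_distrib mult.commute)
  then have "(P 0 powr s + P e powr s) / 2 \<le> P (e / 2) powr s"
    using p by (subst (asm) divide_le_cancel) auto
  with e show False
    by simp
qed

end
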